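(* Let $k\ge 3$. Let $A_1\subseteq A_2\subseteq A_3\subseteq\cdots\subset\mathbb{R}^\infty$ be a sequence of finite sets whose union spans $\mathbb{R}^\infty$ and such that, for every $i$, every element of $A_{i+1}\setminus A_i$ has all of its first $i$ coordinates equal to zero. Then there is no weak subdivision of the associated generalized oriented matroid stratification of $G(k,\mathbb{R}^\infty)$, and there is no weak subdivision of the associated generalized matroid stratification of $G(k,\mathbb{R}^\infty)$.
   Context: Identify $\mathbb{R}^n$ with a subspace of $\mathbb{R}^{n+1}$ (by appending a zero coordinate) and let $\mathbb{R}^\infty=\bigcup_n\mathbb{R}^n$ be the union (colimit), with standard inner product $\langle\cdot,\cdot\rangle$. $G(k,\mathbb{R}^\infty)=\bigcup_n G(k,\mathbb{R}^n)$ is the Grassmannian of $k$-dimensional linear subspaces of $\mathbb{R}^\infty$, with the colimit topology. Generalized stratifications: given $A_1\subseteq A_2\subseteq\cdots$ as in the claim, put $A=\bigcup_i A_i$. The generalized oriented matroid stratification of $G(k,\mathbb{R}^\infty)$ is the partition in which $V$ and $W$ lie in the same stratum if and only if the sets of functions $\{\,a\mapsto \operatorname{sign}\langle v,a\rangle\,\}_{v\in V}$ and $\{\,a\mapsto \operatorname{sign}\langle w,a\rangle\,\}_{w\in W}$ from $A$ to $\{+,-,0\}$ coincide. The generalized matroid stratification is defined in the same way, using functions $A\to\{1,0\}$ obtained by replacing both signs $+$ and $-$ by $1$ (so $a\mapsto 1$ if and only if $\langle v,a\rangle\neq 0$). Weak subdivision: a weak subdivision of a partition $P$ of a space $X$ is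 a partition $Q$ of $X$ such that (i) $Q$ refines $P$, i.e. every element of $P$ is a union of elements of $Q$; (ii) each element of $Q$ is connected; (iii) $Q$ is locally finite, i.e. every compact subset of $X$ intersects only finitely many elements of $Q$; (iv) $Q$ is normal, i.e. if $U$ and $V$ are elements of $Q$ and $U\cap\overline{V}\neq\emptyset$, then $U\subseteq\overline{V}$. *)

theory Defs
  imports "HOL-Analysis.Analysis" "HOL-Library.Disjoint_Sets"
begin

section \<open>The inner product space of finitely supported real sequences\<close>

text \<open>
  Coordinates are indexed from 0, so the first \<open>n\<close> coordinates of \<open>x\<close> are \<open>coord x j\<close> for
  \<open>j < n\<close>.
\<close>

typedef rinf = "{f :: nat \<Rightarrow> real. finite {i. f i \<noteq> 0}}"
  morphisms coord Abs_rinf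
  by (rule exI[of _ "\<lambda>_. 0"]) simp

setup_lifting type_definition_rinf

lemma finite_coord_support [simp]: "finite {i. coord x i \<noteq> 0}"
  using coord[of x] by simp

lemma rinf_eq_iff: "x = y \<longleftrightarrow> (\<forall>i. coord x i = coord y i)"
  by (auto simp flip: coord_inject)

instantiation rinf :: real_vector
begin

lift_definition zero_rinf :: rinf is "\<lambda>_. 0"
  by simp

lift_definition plus_rinf :: "rinf \<Rightarrow> rinf \<Rightarrow> rinf" is "\<lambda>f g i. f i + g i"
  subgoal for f g
    by (rule finite_subset[of _ "{i. f i \<noteq> 0} \<union> {i. g i \<noteq> 0}"]) auto
  done

lift_definition uminus_rinf :: "rinf \<Rightarrow> rinf" is "\<lambda>f i. - f i"
  by simp

lift_definition minus_rinf :: "rinf \<Rightarrow> rinf \<Rightarrow> rinf" is "\<lambda>f g i. f i - g i"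
  subgoal for f g
    by (rule finite_subset[of _ "{i. f i \<noteq> 0} \<union> {i. g i \<noteq> 0}"]) auto
  done

lift_definition scaleR_rinf :: "real \<Rightarrow> rinf \<Rightarrow> rinf" is "\<lambda>r f i. r * f i"
  subgoal for r f
    by (rule finite_subset[of _ "{i. f i \<noteq> 0}"]) auto
  done

instance
  by standard (transfer; simp add: algebra_simps)+

end

lemma coord_zero [simp]: "coord 0 i = 0"
  and coord_add [simp]: "coord (x + y) i = coord x i + coord y i"
  and coord_uminus [simp]: "coord (- x) i = - coord x i"
  and coord_diff [simp]: "coord (x - y) i = coord x i - coord y i"
  and coord_scaleR [simp]: "coord (r *\<^sub>R x) i = r * coord x i"
  by (transfer; simp)+

instantiation rinf :: real_inner
begin

definition inner_rinf :: "rinf \<Rightarrow> rinf \<Rightarrow> real" where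
  "inner_rinf x y = (\<Sum>i | coord x i \<noteq> 0. coord x i * coord y i)"

text \<open>
  The topology of the type is the one of the norm, not the colimit topology.  It is only used on
  the subspaces \<open>Rn n\<close> below, where it is the Euclidean topology.
\<close>

definition norm_rinf :: "rinf \<Rightarrow> real" where
  "norm_rinf x = sqrt (inner x x)"

definition sgn_rinf :: "rinf \<Rightarrow> rinf" where
  "sgn_rinf x = x /\<^sub>R norm x"

definition dist_rinf :: "rinf \<Rightarrow> rinf \<Rightarrow> real" where
  "dist_rinf x y = norm (x - y)"

definition uniformity_rinf :: "(rinf \<times> rinf) filter" where
  "uniformity_rinf = (INF e\<in>{0<..}. principal {(x, y). dist x y < e})"

definition open_rinf :: "rinf set \<Rightarrow> bool" where
  "open_rinf U \<longleftrightarrow> (\<forall>x\<in>U. eventually (\<lambda>(x', y). x' = x \<longrightarrow> y \<in> U) uniformity)"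

lemma inner_rinf_superset:
  assumes "finite S" "{i. coord x i \<noteq> 0} \<subseteq> S"
  shows "inner x y = (\<Sum>i\<in>S. coord x i * coord y i)"
  unfolding inner_rinf_def by (rule sum.mono_neutral_left) (use assms in auto)

instance
proof
  fix x y z :: rinf and r :: real and U :: "rinf set"
  let ?S = "{i. coord x i \<noteq> 0} \<union> {i. coord y i \<noteq> 0}"
  have S: "finite ?S" by simp
  show "inner x y = inner y x"
    by (simp add: inner_rinf_superset[OF S] mult.commute)
  have "{i. coord (x + y) i \<noteq> 0} \<subseteq> ?S" by auto
  then show "inner (x + y) z = inner x z + inner y z"
    by (simp add: inner_rinf_superset[OF S] algebra_simps sum.distrib)
  have "{i. coord (r *\<^sub>R x) i \<noteq> 0} \<subseteq> ?S" by auto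
  then show "inner (r *\<^sub>R x) y = r * inner x y"
    by (simp add: inner_rinf_superset[OF S] sum_distrib_left mult.assoc)
  show "0 \<le> inner x x"
    unfolding inner_rinf_def by (rule sum_nonneg) simp
  show "inner x x = 0 \<longleftrightarrow> x = 0"
    unfolding inner_rinf_def
    by (subst sum_nonneg_eq_0_iff) (auto simp: rinf_eq_iff)
qed (simp_all add: norm_rinf_def sgn_rinf_def dist_rinf_def uniformity_rinf_def open_rinf_def)

end

definition Rn :: "nat \<Rightarrow> rinf set" where
  "Rn n = {x. \<forall>j\<ge>n. coord x j = 0}"

section \<open>Grassmannians\<close>

definition grass :: "nat \<Rightarrow> nat \<Rightarrow> rinf set set" where
  "grass k n = {V. subspace V \<and> V \<subseteq> Rn n \<and> dim V = k}"

definition grass_inf :: "nat \<Rightarrow> rinf set set" where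
  "grass_inf k = (\<Union>n. grass k n)"

definition frame_topology :: "nat \<Rightarrow> nat \<Rightarrow> (nat \<Rightarrow> rinf) topology" where
  "frame_topology k n =
     subtopology (product_topology (\<lambda>_. top_of_set (Rn n)) {..<k})
       {v. inj_on v {..<k} \<and> independent (v ` {..<k})}"

text \<open>
  The usual topology on \<open>grass k n\<close>: the quotient topology for the map that sends a linearly
  independent \<open>k\<close>-frame in \<open>Rn n\<close> to its span.
\<close>

definition grass_topology :: "nat \<Rightarrow> nat \<Rightarrow> rinf set topology" where
  "grass_topology k n = topology (\<lambda>\<U>. \<U> \<subseteq> grass k n \<and>
     openin (frame_topology k n)
       {v \<in> topspace (frame_topology k n). span (v ` {..<k}) \<in> \<U>})"

definition grass_inf_topology :: "nat \<Rightarrow> rinf set topology" where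
  "grass_inf_topology k = topology (\<lambda>\<U>. \<U> \<subseteq> grass_inf k \<and>
     (\<forall>n. openin (grass_topology k n) (\<U> \<inter> grass k n)))"

lemma openin_grass_topology:
  "openin (grass_topology k n) \<U> \<longleftrightarrow> \<U> \<subseteq> grass k n \<and>
     openin (frame_topology k n)
       {v \<in> topspace (frame_topology k n). span (v ` {..<k}) \<in> \<U>}"
proof -
  let ?F = "frame_topology k n"
  let ?pre = "\<lambda>\<U>. {v \<in> topspace ?F. span (v ` {..<k}) \<in> \<U>}"
  have "?pre (S \<inter> T) = ?pre S \<inter> ?pre T" for S T by auto
  moreover have "?pre (\<Union>K) = (\<Union>S\<in>K. ?pre S)" for K by auto
  ultimately have "istopology (\<lambda>\<U>. \<U> \<subseteq> grass k n \<and> openin ?F (?pre \<U>))"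
    unfolding istopology_def by (auto intro!: openin_Int openin_Union)
  then show ?thesis
    by (simp add: grass_topology_def)
qed

lemma span_frame_in_grass:
  assumes "v \<in> topspace (frame_topology k n)"
  shows "span (v ` {..<k}) \<in> grass k n"
proof -
  have "subspace (Rn n)"
    by (auto simp: subspace_def Rn_def)
  moreover have "v ` {..<k} \<subseteq> Rn n"
    using assms by (auto simp: frame_topology_def)
  ultimately have "span (v ` {..<k}) \<subseteq> Rn n"
    by (simp add: span_minimal)
  moreover have "inj_on v {..<k}" "independent (v ` {..<k})"
    using assms by (auto simp: frame_topology_def)
  ultimately show ?thesis
    by (simp add: grass_def dim_eq_card_independent card_image)
qed

lemma topspace_grass_topology [simp]: "topspace (grass_topology k n) = grass k n"
proof
  show "topspace (grass_topology k n) \<subseteq> grass k n"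
    using openin_grass_topology openin_topspace by blast
  have "{v \<in> topspace (frame_topology k n). span (v ` {..<k}) \<in> grass k n}
      = topspace (frame_topology k n)"
    using span_frame_in_grass by blast
  then have "openin (grass_topology k n) (grass k n)"
    by (simp add: openin_grass_topology)
  then show "grass k n \<subseteq> topspace (grass_topology k n)"
    by (rule openin_subset)
qed

lemma openin_grass_inf_topology:
  "openin (grass_inf_topology k) \<U> \<longleftrightarrow> \<U> \<subseteq> grass_inf k \<and>
     (\<forall>n. openin (grass_topology k n) (\<U> \<inter> grass k n))"
proof -
  let ?open = "\<lambda>\<U>. \<U> \<subseteq> grass_inf k \<and> (\<forall>n. openin (grass_topology k n) (\<U> \<inter> grass k n))"
  have "?open (S \<inter> T)" if "?open S" "?open T" for S T
  proof -
    have "openin (grass_topology k n) ((S \<inter> grass k n) \<inter> (T \<inter> grass k n))" for n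
      by (rule openin_Int) (use that in blast)+
    moreover have "(S \<inter> grass k n) \<inter> (T \<inter> grass k n) = S \<inter> T \<inter> grass k n" for n
      by auto
    ultimately show ?thesis using that by auto
  qed
  moreover have "?open (\<Union>K)" if "\<forall>S\<in>K. ?open S" for K
  proof -
    have "openin (grass_topology k n) (\<Union>S\<in>K. S \<inter> grass k n)" for n
      by (rule openin_Union) (use that in blast)
    moreover have "(\<Union>S\<in>K. S \<inter> grass k n) = \<Union>K \<inter> grass k n" for n
      by auto
    ultimately show ?thesis using that by auto
  qed
  ultimately have "istopology ?open"
    unfolding istopology_def by blast
  then show ?thesis
    by (simp add: grass_inf_topology_def)
qed

lemma topspace_grass_inf_topology [simp]: "topspace (grass_inf_topology k) = grass_inf k"
proof
  show "topspace (grass_inf_topology k) \<subseteq> grass_inf k"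
    using openin_grass_inf_topology openin_topspace by blast
  have "grass_inf k \<inter> grass k n = grass k n" for n
    by (auto simp: grass_inf_def)
  then have "openin (grass_inf_topology k) (grass_inf k)"
    using openin_topspace[of "grass_topology k _"] by (simp add: openin_grass_inf_topology)
  then show "grass_inf k \<subseteq> topspace (grass_inf_topology k)"
    by (rule openin_subset)
qed

section \<open>Generalized stratifications\<close>

text \<open>The signs \<open>+\<close>, \<open>-\<close>, \<open>0\<close> are encoded as the real numbers 1, -1, 0.\<close>

definition sign_functions :: "rinf set \<Rightarrow> rinf set \<Rightarrow> (rinf \<Rightarrow> real) set" where
  "sign_functions A V = {(\<lambda>a\<in>A. sgn (inner v a)) | v. v \<in> V}"

definition support_functions :: "rinf set \<Rightarrow> rinf set \<Rightarrow> (rinf \<Rightarrow> nat) set" where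
  "support_functions A V = {(\<lambda>a\<in>A. if inner v a \<noteq> 0 then 1 else 0) | v. v \<in> V}"

definition om_stratification :: "nat \<Rightarrow> rinf set \<Rightarrow> rinf set set set" where
  "om_stratification k A = grass_inf k //
     {(V, W). V \<in> grass_inf k \<and> W \<in> grass_inf k \<and> sign_functions A V = sign_functions A W}"

definition matroid_stratification :: "nat \<Rightarrow> rinf set \<Rightarrow> rinf set set set" where
  "matroid_stratification k A = grass_inf k //
     {(V, W). V \<in> grass_inf k \<and> W \<in> grass_inf k \<and> support_functions A V = support_functions A W}"

lemma partition_on_om_stratification: "partition_on (grass_inf k) (om_stratification k A)"
  unfolding om_stratification_def
  by (rule partition_on_quotient) (auto simp: equiv_def refl_on_def sym_def trans_def)

lemma partition_on_matroid_stratification: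
  "partition_on (grass_inf k) (matroid_stratification k A)"
  unfolding matroid_stratification_def
  by (rule partition_on_quotient) (auto simp: equiv_def refl_on_def sym_def trans_def)

section \<open>Weak subdivisions\<close>

definition weak_subdivision :: "'a topology \<Rightarrow> 'a set set \<Rightarrow> 'a set set \<Rightarrow> bool" where
  "weak_subdivision X P Q \<longleftrightarrow>
     partition_on (topspace X) Q \<and>
     (\<forall>p\<in>P. \<exists>S\<subseteq>Q. p = \<Union>S) \<and>
     (\<forall>U\<in>Q. connectedin X U) \<and>
     (\<forall>K. compactin X K \<longrightarrow> finite {U \<in> Q. U \<inter> K \<noteq> {}}) \<and>
     (\<forall>U\<in>Q. \<forall>V\<in>Q. U \<inter> X closure_of V \<noteq> {} \<longrightarrow> U \<subseteq> X closure_of V)"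

end

theory Submission
  imports Defs
begin

text \<open>
  Elements of \<open>A\<close> with successive disjoint supports form an orthogonal sequence \<open>x\<close>, so the functionals
  that they induce on a subspace \<open>V\<close> can be prescribed freely.  Let \<open>V s\<close> be a subspace on which \<open>x 0\<close>,
  \<open>x 1\<close> and two further members of \<open>x\<close> induce functionals on a line with cross ratio \<open>s\<close>, and on which all
  but finitely many members of \<open>x\<close> vanish.  Arbitrarily near \<open>V (1 / n)\<close> there are subspaces on which
  additional members of \<open>x\<close> are small but nonzero and trace out a von Staudt construction of \<open>n\<close>
  by repeated addition; the matroid of such a subspace forces the cross ratio to be \<open>1 / n\<close>, which is
  a closed condition.

  Since the subspaces \<open>V s\<close> with \<open>0 \<le> s \<le> 1\<close> form a compact set, local finiteness yields \<open>i \<noteq> j\<close> with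
  \<open>V (1 / i)\<close> and \<open>V (1 / j)\<close> in one cell.  This cell meets, hence by normality lies in, the closure of
  a cell whose subspaces all have cross ratio \<open>1 / j\<close>; this contradicts the choice of \<open>V (1 / i)\<close>.
  Oriented matroid strata refine matroid strata, so the same argument covers both statements.
\<close>

section \<open>Linear relations between functionals and the von Staudt chain\<close>

lemma inner_dependent_single:
  fixes a b :: "'a::real_inner"
  assumes V: "subspace V" and "\<And>v. v \<in> V \<Longrightarrow> inner v b = 0 \<Longrightarrow> inner v a = 0"
  shows "\<exists>p. \<forall>v\<in>V. inner v a = p * inner v b"
proof (cases "\<forall>v\<in>V. inner v b = 0")
  case True
  then show ?thesis using assms(2) by auto
next
  case False
  then obtain w where w: "w \<in> V" "inner w b \<noteq> 0" by blast
  have "inner v a = (inner w a / inner w b) * inner v b" if "v \<in> V" for v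
  proof -
    let ?u = "v - (inner v b / inner w b) *\<^sub>R w"
    have "?u \<in> V"
      using V that w by (intro subspace_diff subspace_scale)
    moreover have "inner ?u b = 0"
      using w by (simp add: inner_diff_left)
    ultimately have "inner ?u a = 0" by (rule assms(2))
    then show ?thesis by (simp add: inner_diff_left field_simps)
  qed
  then show ?thesis by blast
qed

text \<open>A matroid only records which functionals vanish together; this turns such data into
  coefficients. On the kernel of \<open>b\<close>, \<open>a\<close> is \<open>q\<close> times
  \<open>c\<close>, so \<open>a - q c\<close> vanishes wherever \<open>b\<close> does.\<close>

lemma inner_dependent_pair:
  fixes a b c :: "'a::real_inner"
  assumes V: "subspace V"
    and dep: "\<And>v. v \<in> V \<Longrightarrow> inner v b = 0 \<Longrightarrow> inner v c = 0 \<Longrightarrow> inner v a = 0"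
  obtains p q where "\<And>v. v \<in> V \<Longrightarrow> inner v a = p * inner v b + q * inner v c"
proof -
  let ?V = "V \<inter> {v. inner v b = 0}"
  have "subspace {v. inner v b = 0}"
    by (simp add: subspace_def inner_add_left)
  then have "subspace ?V" using V by (rule subspace_inter[rotated])
  then obtain q where q: "\<forall>v\<in>?V. inner v a = q * inner v c"
    using inner_dependent_single[of ?V c a] dep by auto
  have "inner v (a - q *\<^sub>R c) = 0" if "v \<in> V" "inner v b = 0" for v
    using q that by (simp add: inner_diff_right)
  then obtain p where "\<forall>v\<in>V. inner v (a - q *\<^sub>R c) = p * inner v b"
    using inner_dependent_single[OF V, of b "a - q *\<^sub>R c"] by blast
  then show thesis
    by (intro that[of p q]) (simp add: inner_diff_right algebra_simps)
qed

text \<open>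
  The functionals on \<open>V\<close> induced by \<open>a\<close>, \<open>b\<close>, \<open>c\<close>, \<open>d\<close> have cross ratio \<open>1 / n\<close>.  The denominators are
  cleared, so the condition is closed, but it also holds for degenerate configurations.
\<close>

definition minor :: "rinf \<Rightarrow> rinf \<Rightarrow> rinf \<Rightarrow> rinf \<Rightarrow> real" where
  "minor v w a b = inner v a * inner w b - inner w a * inner v b"

definition cross_condition :: "nat \<Rightarrow> rinf \<Rightarrow> rinf \<Rightarrow> rinf \<Rightarrow> rinf \<Rightarrow> rinf set \<Rightarrow> bool" where
  "cross_condition n a b c d V \<longleftrightarrow> (\<forall>v\<in>V. \<forall>w\<in>V.
     real n * minor v w a c * minor v w b d = minor v w b c * minor v w a d)"

text \<open>
  After rescaling \<open>a\<close>, \<open>b\<close>, \<open>e\<close> one has \<open>c = a + b\<close>, \<open>q = a + e\<close> and \<open>m = b - e\<close> up to factors; then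
  inductively \<open>y i = a + i b\<close> and \<open>z i = a + i b + e\<close> up to factors.
\<close>

lemma von_staudt_chain:
  fixes a b c d e q m :: rinf and y z :: "nat \<Rightarrow> rinf"
  assumes V: "subspace V"
    and w0: "w0 \<in> V" "inner w0 a \<noteq> 0" "inner w0 b = 0" "inner w0 e = 0" "inner w0 c \<noteq> 0"
      "inner w0 q \<noteq> 0"
    and w1: "w1 \<in> V" "inner w1 a = 0" "inner w1 b \<noteq> 0" "inner w1 e = 0" "inner w1 c \<noteq> 0"
    and w2: "w2 \<in> V" "inner w2 a = 0" "inner w2 b = 0" "inner w2 e \<noteq> 0" "inner w2 q \<noteq> 0"
    and c_ab: "\<And>v. v \<in> V \<Longrightarrow> inner v a = 0 \<Longrightarrow> inner v b = 0 \<Longrightarrow> inner v c = 0"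
    and q_ae: "\<And>v. v \<in> V \<Longrightarrow> inner v a = 0 \<Longrightarrow> inner v e = 0 \<Longrightarrow> inner v q = 0"
    and m_be: "\<And>v. v \<in> V \<Longrightarrow> inner v b = 0 \<Longrightarrow> inner v e = 0 \<Longrightarrow> inner v m = 0"
    and c_qm: "\<And>v. v \<in> V \<Longrightarrow> inner v q = 0 \<Longrightarrow> inner v m = 0 \<Longrightarrow> inner v c = 0"
    and y0: "\<And>v. v \<in> V \<Longrightarrow> inner v a = 0 \<Longrightarrow> inner v (y 0) = 0"
    and y_ab: "\<And>v i. i \<le> n \<Longrightarrow> v \<in> V \<Longrightarrow> inner v a = 0 \<Longrightarrow> inner v b = 0 \<Longrightarrow> inner v (y i) = 0"
    and z_qb: "\<And>v i. i \<le> n \<Longrightarrow> v \<in> V \<Longrightarrow> inner v q = 0 \<Longrightarrow> inner v b = 0 \<Longrightarrow> inner v (z i) = 0"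
    and z_ye: "\<And>v i. i \<le> n \<Longrightarrow> v \<in> V \<Longrightarrow> inner v (y i) = 0 \<Longrightarrow> inner v e = 0 \<Longrightarrow> inner v (z i) = 0"
    and y_zm: "\<And>v i. i < n \<Longrightarrow> v \<in> V \<Longrightarrow> inner v (z i) = 0 \<Longrightarrow> inner v m = 0
      \<Longrightarrow> inner v (y (Suc i)) = 0"
    and d_y: "\<And>v. v \<in> V \<Longrightarrow> inner v (y n) = 0 \<Longrightarrow> inner v d = 0"
  shows "cross_condition n a b c d V"
proof -
  obtain p r where c: "\<And>v. v \<in> V \<Longrightarrow> inner v c = p * inner v a + r * inner v b"
    using inner_dependent_pair[OF V c_ab] by blast
  have p: "p \<noteq> 0" and r: "r \<noteq> 0"
    using c[OF w0(1)] c[OF w1(1)] w0 w1 by auto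
  obtain g h where q: "\<And>v. v \<in> V \<Longrightarrow> inner v q = g * inner v a + h * inner v e"
    using inner_dependent_pair[OF V q_ae] by blast
  have g: "g \<noteq> 0" and h: "h \<noteq> 0"
    using q[OF w0(1)] q[OF w2(1)] w0 w2 by auto
  obtain m1 m2 where m: "\<And>v. v \<in> V \<Longrightarrow> inner v m = m1 * inner v b + m2 * inner v e"
    using inner_dependent_pair[OF V m_be] by blast
  obtain l1 l2 where cq: "\<And>v. v \<in> V \<Longrightarrow> inner v c = l1 * inner v q + l2 * inner v m"
    using inner_dependent_pair[OF V c_qm] by blast
  \<comment> \<open>Each of \<open>w0\<close>, \<open>w1\<close>, \<open>w2\<close> kills all but
    one of \<open>a\<close>, \<open>b\<close>, \<open>e\<close>, so evaluating there compares
    coefficients in the two expressions for \<open>c\<close>.\<close>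
  have 1: "p = l1 * g"
    using c[OF w0(1)] cq[OF w0(1)] q[OF w0(1)] m[OF w0(1)] w0 by simp
  have 2: "r = l2 * m1"
    using c[OF w1(1)] cq[OF w1(1)] q[OF w1(1)] m[OF w1(1)] w1 by simp
  have "(l1 * h + l2 * m2) * inner w2 e = 0"
    using c[OF w2(1)] cq[OF w2(1)] q[OF w2(1)] m[OF w2(1)] w2 by (simp add: algebra_simps)
  then have 3: "l1 * h + l2 * m2 = 0" using w2 by simp
  have l: "l1 \<noteq> 0" "l2 \<noteq> 0" using 1 2 p r by auto
  then have m2: "m2 \<noteq> 0" using 3 h by auto
  \<comment> \<open>No point \<open>y i\<close> is assumed nonzero, so \<open>t\<close> may vanish;
    the cleared denominators of \<open>cross_condition\<close> absorb this.\<close>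
  have y: "\<exists>t. \<forall>v\<in>V. inner v (y i) = t * (p * inner v a + real i * r * inner v b)" if "i \<le> n" for i
    using that
  proof (induction i)
    case 0
    obtain t where "\<forall>v\<in>V. inner v (y 0) = t * inner v a"
      using inner_dependent_single[OF V y0] by blast
    then show ?case using p by (intro exI[of _ "t / p"]) simp
  next
    case (Suc i)
    then obtain t where t: "\<And>v. v \<in> V \<Longrightarrow> inner v (y i) = t * (p * inner v a + real i * r * inner v b)"
      by auto
    have i: "i \<le> n" "i < n" using Suc by auto
    obtain s1 s2 where s: "\<And>v. v \<in> V \<Longrightarrow> inner v (z i) = s1 * inner v q + s2 * inner v b"
      using inner_dependent_pair[OF V z_qb[OF i(1)]] by blast
    obtain u1 u2 where u: "\<And>v. v \<in> V \<Longrightarrow> inner v (z i) = u1 * inner v (y i) + u2 * inner v e"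
      using inner_dependent_pair[OF V z_ye[OF i(1)]] by blast
    have 4: "s1 * g = u1 * t * p"
      using s[OF w0(1)] u[OF w0(1)] t[OF w0(1)] q[OF w0(1)] w0 by simp
    have 5: "s2 = u1 * t * real i * r"
      using s[OF w1(1)] u[OF w1(1)] t[OF w1(1)] q[OF w1(1)] w1 by simp
    \<comment> \<open>The two lines through \<open>z i\<close> fix it as
      \<open>k (l1 q + i r b)\<close>.\<close>
    define k where "k = u1 * t"
    have k: "s1 = k * l1" "s2 = k * real i * r"
      using 4 5 1 g by (auto simp: k_def)
    obtain f1 f2 where f: "\<And>v. v \<in> V \<Longrightarrow> inner v (y (Suc i)) = f1 * inner v (z i) + f2 * inner v m"
      using inner_dependent_pair[OF V y_zm[OF i(2)]] by blast
    obtain x1 x2 where x: "\<And>v. v \<in> V \<Longrightarrow> inner v (y (Suc i)) = x1 * inner v a + x2 * inner v b"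
      using inner_dependent_pair[OF V y_ab[OF Suc.prems]] by blast
    \<comment> \<open>By \<open>x\<close>, \<open>y (Suc i)\<close> has no \<open>e\<close>
      component; with 3 this determines the multiple \<open>f2\<close> of \<open>m\<close>.\<close>
    have "(f1 * (k * l1) * h + f2 * m2) * inner w2 e = 0"
      using f[OF w2(1)] x[OF w2(1)] s[OF w2(1)] q[OF w2(1)] m[OF w2(1)] w2 k
      by (simp add: algebra_simps)
    then have "f1 * (k * l1) * h + f2 * m2 = 0" using w2 by simp
    then have "(f2 - f1 * k * l2) * m2 = 0"
      using 3 by algebra
    then have f2: "f2 = f1 * k * l2" using m2 by simp
    have "inner v (y (Suc i)) = f1 * k * (p * inner v a + real (Suc i) * r * inner v b)"
      if v: "v \<in> V" for v
    proof -
      have "inner v (y (Suc i)) = f1 * k * (l1 * g * inner v a + real i * r * inner v b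
          + l2 * m1 * inner v b + (l1 * h + l2 * m2) * inner v e)"
        by (simp add: f[OF v] s[OF v] q[OF v] m[OF v] k f2 algebra_simps)
      then show ?thesis
        unfolding 3 by (simp add: 1 2 algebra_simps)
    qed
    then show ?case by blast
  qed
  obtain t where t: "\<And>v. v \<in> V \<Longrightarrow> inner v (y n) = t * (p * inner v a + real n * r * inner v b)"
    using y[of n] by blast
  obtain t' where t': "\<And>v. v \<in> V \<Longrightarrow> inner v d = t' * inner v (y n)"
    using inner_dependent_single[OF V d_y] by blast
  \<comment> \<open>Both sides equal \<open>- n p r t t'\<close> times the square of
    \<open>minor v w a b\<close>.\<close>
  show ?thesis
    unfolding cross_condition_def minor_def
    by (auto simp: c t t' algebra_simps)
qed

section \<open>Orthogonal sequences with separated supports\<close>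

lemma subspace_Rn: "subspace (Rn n)"
  by (auto simp: subspace_def Rn_def)

lemma Rn_mono: "m \<le> n \<Longrightarrow> Rn m \<subseteq> Rn n"
  by (auto simp: Rn_def)

lemma ex_Rn: "\<exists>n. x \<in> Rn n"
proof -
  have "finite {i. coord x i \<noteq> 0}" by simp
  then obtain n where "\<forall>i\<in>{i. coord x i \<noteq> 0}. i < n"
    using finite_nat_set_iff_bounded by blast
  then have "x \<in> Rn n" by (force simp: Rn_def)
  then show ?thesis ..
qed

lemma finite_subset_Rn: "finite S \<Longrightarrow> \<exists>n. S \<subseteq> Rn n"
proof (induction rule: finite_induct)
  case (insert x S)
  then obtain m n where "S \<subseteq> Rn m" "x \<in> Rn n" using ex_Rn by blast
  then have "insert x S \<subseteq> Rn (max m n)"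
    using Rn_mono[of m "max m n"] Rn_mono[of n "max m n"] by auto
  then show ?case ..
qed auto

lemma Rn_neq_UNIV: "Rn n \<noteq> UNIV"
proof -
  have "finite {i. (if i = n then 1 else 0 :: real) \<noteq> 0}" by simp
  then have "coord (Abs_rinf (\<lambda>i. if i = n then 1 else 0)) n = 1"
    by (subst Abs_rinf_inverse) auto
  then have "Abs_rinf (\<lambda>i. if i = n then 1 else 0) \<notin> Rn n"
    by (auto simp: Rn_def)
  then show ?thesis by blast
qed

lemma inner_separated_support:
  assumes "x \<in> Rn n" "\<And>j. j < n \<Longrightarrow> coord y j = 0"
  shows "inner x y = 0"
  unfolding inner_rinf_def using assms
  by (intro sum.neutral) (auto simp: Rn_def not_le[symmetric])

text \<open>\<open>N l\<close> bounds the supports of all elements chosen before step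
  \<open>l\<close>, and the next element vanishes on the first \<open>N l\<close>
  coordinates.\<close>

lemma ex_orthogonal_sequence:
  assumes "\<And>n. \<exists>a\<in>S. a \<noteq> 0 \<and> (\<forall>j<n. coord a j = 0)"
  shows "\<exists>x :: nat \<Rightarrow> rinf. (\<forall>l. x l \<in> S \<and> x l \<noteq> 0) \<and> (\<forall>l l'. l \<noteq> l' \<longrightarrow> inner (x l) (x l') = 0)"
proof -
  obtain f where f: "\<And>n. f n \<in> S" "\<And>n. f n \<noteq> 0" "\<And>n j. j < n \<Longrightarrow> coord (f n) j = 0"
    using assms by metis
  obtain M where M: "\<And>x. x \<in> Rn (M x)" using ex_Rn by metis
  define N where "N = rec_nat 0 (\<lambda>_ n. max n (M (f n)))"
  have N: "N (Suc l) = max (N l) (M (f (N l)))" for l by (simp add: N_def)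
  have "mono N" by (rule incseq_SucI[unfolded incseq_def, folded mono_def]) (simp add: N)
  have "inner (f (N l)) (f (N l')) = 0" if "l < l'" for l l'
  proof (rule inner_separated_support)
    show "f (N l) \<in> Rn (N (Suc l))"
      using M[of "f (N l)"] Rn_mono[of "M (f (N l))" "N (Suc l)"] N[of l] by auto
    show "coord (f (N l')) j = 0" if "j < N (Suc l)" for j
      using that f(3) monoD[OF \<open>mono N\<close>, of "Suc l" l'] \<open>l < l'\<close> by simp
  qed
  then have "inner (f (N l)) (f (N l')) = 0" if "l \<noteq> l'" for l l'
    using that by (metis inner_commute linorder_neqE_nat)
  then show ?thesis using f by (intro exI[of _ "\<lambda>l. f (N l)"]) auto
qed

section \<open>Frames and the topology of the Grassmannian\<close>

lemma biorthogonal_independent: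
  fixes v x :: "nat \<Rightarrow> 'a::real_inner"
  assumes "\<And>i j. i < k \<Longrightarrow> j < k \<Longrightarrow> inner (v j) (x i) = (if i = j then 1 else 0)"
  shows "inj_on v {..<k}" "independent (v ` {..<k})"
proof -
  show "inj_on v {..<k}"
    by (rule inj_onI) (metis assms lessThan_iff zero_neq_one)
  show "independent (v ` {..<k})"
    unfolding dependent_def
  proof (clarify)
    fix j assume "j < k" and j: "v j \<in> span (v ` {..<k} - {v j})"
    \<comment> \<open>The functional of \<open>x j\<close> kills the other frame vectors, hence
      their span, but not \<open>v j\<close>.\<close>
    have "subspace {w. inner w (x j) = 0}"
      by (simp add: subspace_def inner_add_left)
    moreover have "v ` {..<k} - {v j} \<subseteq> {w. inner w (x j) = 0}"
      using assms \<open>j < k\<close> by auto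
    ultimately have "span (v ` {..<k} - {v j}) \<subseteq> {w. inner w (x j) = 0}"
      by (rule span_minimal[rotated])
    then show False using j assms[OF \<open>j < k\<close> \<open>j < k\<close>] by auto
  qed
qed

text \<open>The map factors through the frames, the quotient map to \<open>grass k n\<close> and the
  inclusion into the colimit.\<close>

lemma continuous_map_span_frame:
  assumes Rn: "\<And>t j. t \<in> I \<Longrightarrow> j < k \<Longrightarrow> v t j \<in> Rn n"
    and cont: "\<And>j. j < k \<Longrightarrow> continuous_on I (\<lambda>t. v t j)"
    and ind: "\<And>t. t \<in> I \<Longrightarrow> inj_on (v t) {..<k} \<and> independent (v t ` {..<k})"
  shows "continuous_map (top_of_set I) (grass_inf_topology k) (\<lambda>t. span (v t ` {..<k}))"
proof -
  \<comment> \<open>Points of the product topology are extensional on \<open>{..<k}\<close>.\<close>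
  let ?r = "\<lambda>t. restrict (v t) {..<k}"
  have im: "?r t ` {..<k} = v t ` {..<k}" for t by auto
  have 1: "continuous_map (top_of_set I) (frame_topology k n) ?r"
    unfolding frame_topology_def continuous_map_in_subtopology
  proof
    show "continuous_map (top_of_set I) (product_topology (\<lambda>_. top_of_set (Rn n)) {..<k}) ?r"
      using Rn cont
      by (auto simp: continuous_map_componentwise continuous_map_in_subtopology)
    show "?r \<in> topspace (top_of_set I) \<rightarrow> {v. inj_on v {..<k} \<and> independent (v ` {..<k})}"
      using ind by (auto simp: inj_on_def)
  qed
  have 2: "continuous_map (frame_topology k n) (grass_topology k n) (\<lambda>v. span (v ` {..<k}))"
    using span_frame_in_grass by (auto simp: continuous_map_def openin_grass_topology)
  have 3: "continuous_map (grass_topology k n) (grass_inf_topology k) (\<lambda>V. V)"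
    by (auto simp: continuous_map_def openin_grass_inf_topology grass_inf_def Collect_conj_eq Int_commute)
  show ?thesis
    using continuous_map_compose[OF continuous_map_compose[OF 1 2] 3] by (simp add: o_def im)
qed

text \<open>Pulled back to frames, vectors of the span are combinations with fixed coefficients. For
  each pair of coefficient families, failure of the identity is an open condition on the frame, and
  the complement is the union of these.\<close>

lemma closedin_cross_condition:
  "closedin (grass_inf_topology k) {V \<in> grass_inf k. cross_condition n a b c d V}"
proof -
  let ?P = "\<lambda>v w. real n * minor v w a c * minor v w b d - minor v w b c * minor v w a d"
  have "openin (grass_topology k N) ({V \<in> grass_inf k. \<not> cross_condition n a b c d V} \<inter> grass k N)" for N
  proof -
    let ?X = "frame_topology k N"
    let ?l = "\<lambda>s v. \<Sum>j<k. s j *\<^sub>R v j :: rinf"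
    have proj: "continuous_map ?X euclidean (\<lambda>v. v j)" if "j < k" for j
    proof -
      have "continuous_map (product_topology (\<lambda>_. top_of_set (Rn N)) {..<k}) (top_of_set (Rn N)) (\<lambda>v. v j)"
        using that by (intro continuous_map_product_projection) auto
      then show ?thesis
        unfolding frame_topology_def
        by (intro continuous_map_from_subtopology) (simp add: continuous_map_in_subtopology)
    qed
    have "continuous_map ?X euclideanreal (\<lambda>v. inner (v j) u)" if "j < k" for j u
      using continuous_map_compose[OF proj[OF that], of euclideanreal "\<lambda>w. inner w u"]
      by (simp add: o_def continuous_on_inner continuous_on_id continuous_on_const)
    then have inner: "continuous_map ?X euclideanreal (\<lambda>v. inner (?l s v) u)" for s u
      unfolding inner_sum_left inner_scaleR_left
      by (intro continuous_map_sum continuous_map_real_mult) auto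
    have "continuous_map ?X euclideanreal (\<lambda>v. minor (?l s v) (?l s' v) u u')" for s s' u u'
      unfolding minor_def by (intro continuous_map_diff continuous_map_real_mult inner)
    then have P: "continuous_map ?X euclideanreal (\<lambda>v. ?P (?l s v) (?l s' v))" for s s'
      by (intro continuous_map_diff continuous_map_real_mult) auto
    have op: "openin ?X {v \<in> topspace ?X. ?P (?l s v) (?l s' v) \<in> - {0}}" for s s'
      using openin_continuous_map_preimage[OF P, of "- {0}"] by auto
    have "{v \<in> topspace ?X. \<not> cross_condition n a b c d (span (v ` {..<k}))}
      = (\<Union>s. \<Union>s'. {v \<in> topspace ?X. ?P (?l s v) (?l s' v) \<in> - {0}})" (is "?L = ?R")
    proof
      show "?R \<subseteq> ?L"
      proof clarsimp
        fix s s' v assume *: "v \<in> topspace ?X" "cross_condition n a b c d (span (v ` {..<k}))"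
          "real n * minor (?l s v) (?l s' v) a c * minor (?l s v) (?l s' v) b d
            \<noteq> minor (?l s v) (?l s' v) b c * minor (?l s v) (?l s' v) a d"
        have "?l s v \<in> span (v ` {..<k})" for s
          by (intro span_sum span_scale span_base) auto
        then show False using * unfolding cross_condition_def by blast
      qed
      show "?L \<subseteq> ?R"
      proof
        fix v assume "v \<in> ?L"
        then obtain u w where v: "v \<in> topspace ?X" "u \<in> span (v ` {..<k})" "w \<in> span (v ` {..<k})"
          "?P u w \<noteq> 0"
          by (auto simp: cross_condition_def)
        have "inj_on v {..<k}" using v by (simp add: frame_topology_def)
        have "\<exists>s. u = ?l s v" if u: "u \<in> span (v ` {..<k})" for u
        proof -
          obtain s where "u = (\<Sum>x\<in>v ` {..<k}. s x *\<^sub>R x)"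
            using u unfolding span_finite[OF finite_imageI[OF finite_lessThan]] by blast
          then have "u = ?l (s \<circ> v) v"
            by (simp add: sum.reindex[OF \<open>inj_on v {..<k}\<close>])
          then show ?thesis by blast
        qed
        then obtain s s' where "u = ?l s v" "w = ?l s' v" using v by metis
        then show "v \<in> ?R" using v by auto
      qed
    qed
    moreover have "openin ?X ?R" by (intro openin_Union) (use op in auto)
    moreover have "{v \<in> topspace ?X. span (v ` {..<k}) \<in>
        {V \<in> grass_inf k. \<not> cross_condition n a b c d V} \<inter> grass k N} = ?L"
      using span_frame_in_grass by (auto simp: grass_inf_def)
    ultimately show ?thesis
      by (auto simp: openin_grass_topology)
  qed
  then have "openin (grass_inf_topology k) {V \<in> grass_inf k. \<not> cross_condition n a b c d V}"
    by (auto simp: openin_grass_inf_topology)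
  moreover have "grass_inf k - {V \<in> grass_inf k. cross_condition n a b c d V}
     = {V \<in> grass_inf k. \<not> cross_condition n a b c d V}" by auto
  ultimately show ?thesis by (auto simp: closedin_def)
qed

section \<open>Local finiteness along a path\<close>

lemma locally_finite_path_start:
  assumes Q: "partition_on (topspace X) Q"
    and fin: "\<And>K. compactin X K \<Longrightarrow> finite {U \<in> Q. U \<inter> K \<noteq> {}}"
    and g: "continuous_map (top_of_set {0..1::real}) X g"
  obtains T t where "T \<in> Q" "g 0 \<in> X closure_of T" "0 < t" "t \<le> 1" "g t \<in> T"
proof -
  let ?I = "top_of_set {0..1::real}"
  let ?F = "{U \<in> Q. U \<inter> g ` {0<..1} \<noteq> {}}"
  have "compactin X (g ` {0..1})"
    by (rule image_compactin[OF _ g]) (simp add: compactin_subtopology)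
  from fin[OF this] have "finite {U \<in> Q. U \<inter> g ` {0..1} \<noteq> {}}" .
  then have "finite ?F" by (rule rev_finite_subset) auto
  have "0 \<in> closure {0<..1::real}" by simp
  then have "0 \<in> ?I closure_of {0<..1}" 
    unfolding closure_of_subtopology by (simp add: greaterThanAtMost_subseteq_atLeastAtMost_iff Int_absorb1)
  then have "g 0 \<in> X closure_of (g ` {0<..1})"
    using continuous_map_image_closure_subset[OF g, of "{0<..1}"] by (metis image_subset_iff)
  moreover have "g ` {0<..1} \<subseteq> \<Union>?F"
  proof (rule image_subsetI)
    fix t :: real assume t: "t \<in> {0<..1}"
    then have "g t \<in> \<Union>Q"
      using continuous_map_funspace[OF g] partition_onD1[OF Q] by (simp add: Pi_iff)
    then show "g t \<in> \<Union>?F" using t by blast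
  qed
  ultimately have "g 0 \<in> X closure_of \<Union>?F"
    using closure_of_mono[of "g ` {0<..1}" "\<Union>?F" X] by (metis (no_types, lifting) subsetD)
  \<comment> \<open>Only finitely many cells meet the path after its start, and closure commutes
    with finite unions.\<close>
  also have "\<dots> = (\<Union>U\<in>?F. X closure_of U)"
    using \<open>finite ?F\<close> by (rule closure_of_Union)
  finally obtain T where "T \<in> ?F" "g 0 \<in> X closure_of T" by blast
  then show thesis using that by auto
qed

section \<open>Strata and support functions\<close>

lemma support_functions_eqD:
  assumes eq: "support_functions S V = support_functions S W" and v: "v \<in> V"
  shows "\<exists>w\<in>W. \<forall>a\<in>S. inner w a = 0 \<longleftrightarrow> inner v a = 0"
proof -
  have "(\<lambda>a\<in>S. if inner v a \<noteq> 0 then 1 else 0) \<in> support_functions S V"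
    unfolding support_functions_def by (rule CollectI) (intro exI[of _ v] conjI refl v)
  then have "\<exists>w. (\<lambda>a\<in>S. if inner v a \<noteq> 0 then 1 else 0 :: nat) =
      (\<lambda>a\<in>S. if inner w a \<noteq> 0 then 1 else 0) \<and> w \<in> W"
    unfolding eq unfolding support_functions_def by (rule CollectD)
  then obtain w where w: "(\<lambda>a\<in>S. if inner v a \<noteq> 0 then 1 else 0 :: nat) =
      (\<lambda>a\<in>S. if inner w a \<noteq> 0 then 1 else 0)" "w \<in> W" by (elim exE conjE)
  have "inner w a = 0 \<longleftrightarrow> inner v a = 0" if "a \<in> S" for a
    using fun_cong[OF w(1), of a] that by (simp split: if_splits)
  with w(2) show ?thesis by (intro bexI[of _ w] ballI)
qed

text \<open>Support functions are the images of sign functions under the map \<open>g\<close> that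
  forgets the two signs.\<close>

lemma sign_functions_eq_imp_support_functions_eq:
  assumes "sign_functions S V = sign_functions S W"
  shows "support_functions S V = support_functions S W"
proof -
  define g where "g f = (\<lambda>a\<in>S. if f a \<noteq> (0::real) then 1 else 0 :: nat)" for f :: "rinf \<Rightarrow> real"
  have "g (\<lambda>a\<in>S. sgn (inner v a)) = (\<lambda>a\<in>S. if inner v a \<noteq> 0 then 1 else 0)" for v
    by (simp add: g_def sgn_zero_iff cong: restrict_cong)
  then have "support_functions S V = g ` sign_functions S V" for V
    by (simp add: support_functions_def sign_functions_def setcompr_eq_image image_image)
  then show ?thesis using assms by simp
qed

text \<open>Cells are disjoint, so a class that is a union of cells contains every cell it
  meets.\<close>

lemma partition_quotient_refinement:
  assumes Q: "partition_on X Q"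
    and ref: "\<forall>p\<in>X // {(V, W). V \<in> X \<and> W \<in> X \<and> f V = f W}. \<exists>S\<subseteq>Q. p = \<Union>S"
    and U: "U \<in> Q" "V \<in> U" "W \<in> U"
  shows "f V = f W"
proof -
  define r where "r = {(V, W). V \<in> X \<and> W \<in> X \<and> f V = f W}"
  have "V \<in> X" using partition_onD1[OF Q] U by blast
  then have V: "r `` {V} \<in> X // r" "V \<in> r `` {V}"
    by (rule quotientI) (simp add: r_def \<open>V \<in> X\<close>)
  from bspec[OF ref[folded r_def] V(1)] obtain S where S: "S \<subseteq> Q" "r `` {V} = \<Union>S"
    by (elim exE conjE)
  obtain T where T: "T \<in> S" "V \<in> T" using V(2) unfolding S(2) by (rule UnionE)
  have "T = U"
    using partition_onD2[OF Q] T U S(1) unfolding disjoint_def by blast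
  then have "W \<in> r `` {V}" using T(1) U(3) unfolding S(2) by blast
  then show ?thesis by (simp add: r_def)
qed

section \<open>Explicit frames realizing the chain\<close>

text \<open>
  Row \<open>l\<close> expresses the functional of \<open>x (k + l)\<close> by the functionals \<open>u\<^sub>0, u\<^sub>1, u\<^sub>2\<close> of \<open>x 0, x 1, x 2\<close>.
  The rows are \<open>u\<^sub>0 + u\<^sub>1\<close>, \<open>s u\<^sub>0 + u\<^sub>1\<close>, \<open>u\<^sub>0 + u\<^sub>2\<close>, \<open>u\<^sub>1 - u\<^sub>2\<close> (the points \<open>c, d, q, m\<close> of
  \<open>von_staudt_chain\<close>), followed by \<open>\<epsilon> (u\<^sub>0 + i u\<^sub>1)\<close> in row \<open>4 + 2 i\<close> and \<open>\<epsilon> (u\<^sub>0 + i u\<^sub>1 + u\<^sub>2)\<close>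
  in row \<open>5 + 2 i\<close> (the points \<open>y i\<close> and \<open>z i\<close>).
\<close>

definition chain_coeff :: "real \<Rightarrow> real \<Rightarrow> nat \<Rightarrow> nat \<Rightarrow> real" where
  "chain_coeff s \<epsilon> l j =
    (if l = 0 then (if j = 2 then 0 else 1)
     else if l = 1 then (if j = 0 then s else if j = 1 then 1 else 0)
     else if l = 2 then (if j = 1 then 0 else 1)
     else if l = 3 then (if j = 0 then 0 else if j = 1 then 1 else - 1)
     else \<epsilon> * (if j = 0 then 1 else if j = 1 then real ((l - 4) div 2) else if odd l then 1 else 0))"

lemma continuous_on_chain_coeff:
  assumes "continuous_on I s" "continuous_on I \<epsilon>"
  shows "continuous_on I (\<lambda>t. chain_coeff (s t) (\<epsilon> t) l j)"
proof -
  consider "l = 0" | "l = 1" "j = 0" | "l = 1" "j > 0" | "l = 2" | "l = 3" | "l > 3" by linarith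
  then show ?thesis
    unfolding chain_coeff_def by cases (use assms in \<open>auto intro!: continuous_intros\<close>)
qed

locale orthogonal_sequence =
  fixes k :: nat and x :: "nat \<Rightarrow> rinf"
  assumes k: "k \<ge> 3"
    and nonzero: "\<And>l. x l \<noteq> 0"
    and orthogonal: "\<And>l l'. l \<noteq> l' \<Longrightarrow> inner (x l) (x l') = 0"
begin

definition dual :: "nat \<Rightarrow> rinf" where
  "dual l = x l /\<^sub>R inner (x l) (x l)"

lemma inner_dual: "inner (dual l) (x m) = (if l = m then 1 else 0)"
  using nonzero orthogonal by (simp add: dual_def)

text \<open>Column \<open>j\<close> of \<open>c\<close> modifies frame vector \<open>j\<close>, so
  that row \<open>l\<close> becomes the linear relation for \<open>x (k + l)\<close>. Three columns
  suffice because the chain is a plane configuration.\<close>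

definition frame :: "(nat \<Rightarrow> nat \<Rightarrow> real) \<Rightarrow> nat \<Rightarrow> nat \<Rightarrow> rinf" where
  "frame c N j = dual j + (if j < 3 then \<Sum>l<N. c l j *\<^sub>R dual (k + l) else 0)"

definition frame_span :: "(nat \<Rightarrow> nat \<Rightarrow> real) \<Rightarrow> nat \<Rightarrow> rinf set" where
  "frame_span c N = span (frame c N ` {..<k})"

lemma inner_frame_basis:
  "m < k \<Longrightarrow> j < k \<Longrightarrow> inner (frame c N j) (x m) = (if m = j then 1 else 0)"
  by (auto simp: frame_def inner_add_left inner_sum_left inner_dual intro!: sum.neutral)

lemma inner_frame_extra:
  assumes "l < N" "j < k"
  shows "inner (frame c N j) (x (k + l)) = (if j < 3 then c l j else 0)"
proof -
  have "(\<Sum>i<N. c i j * (if i = l then 1 else 0)) = (\<Sum>i<N. if i = l then c i j else 0)"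
    by (intro sum.cong) auto
  then show ?thesis using assms
    by (auto simp: frame_def inner_add_left inner_sum_left inner_dual sum.delta)
qed

lemma frame_in_frame_span: "j < k \<Longrightarrow> frame c N j \<in> frame_span c N"
  by (auto simp: frame_span_def intro: span_base)

text \<open>The relation is linear in \<open>v\<close>, so frame vectors suffice; for
  \<open>j \<ge> 3\<close> both sides are zero.\<close>

lemma frame_span_relation:
  assumes "v \<in> frame_span c N" "l < N"
  shows "inner v (x (k + l)) = c l 0 * inner v (x 0) + c l 1 * inner v (x 1) + c l 2 * inner v (x 2)"
proof -
  let ?S = "{v. inner v (x (k + l)) = c l 0 * inner v (x 0) + c l 1 * inner v (x 1) + c l 2 * inner v (x 2)}"
  have "subspace ?S"
    by (simp add: subspace_def inner_add_left algebra_simps)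
  moreover have "frame c N j \<in> ?S" if "j < k" for j
  proof -
    consider "j = 0" | "j = 1" | "j = 2" | "j \<ge> 3" by linarith
    then show ?thesis
      using that k \<open>l < N\<close> by cases (simp_all add: inner_frame_extra inner_frame_basis)
  qed
  ultimately have "frame_span c N \<subseteq> ?S"
    unfolding frame_span_def by (intro span_minimal) auto
  then show ?thesis using assms by blast
qed

lemma continuous_map_frame_span:
  assumes "\<And>l j. continuous_on I (\<lambda>t. c t l j)"
  shows "continuous_map (top_of_set I) (grass_inf_topology k) (\<lambda>t. frame_span (c t) N)"
proof -
  obtain M where M: "dual ` {..<k + N} \<subseteq> Rn M"
    using finite_subset_Rn[of "dual ` {..<k + N}"] by blast
  show ?thesis
    unfolding frame_span_def
  proof (rule continuous_map_span_frame)
    show "frame (c t) N j \<in> Rn M" if "j < k" for t j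
    proof -
      have "dual l \<in> Rn M" if "l < k + N" for l using M that by blast
      then have "(\<Sum>l<N. c t l j *\<^sub>R dual (k + l)) \<in> Rn M"
        by (intro subspace_sum[OF subspace_Rn] subspace_scale[OF subspace_Rn]) simp
      moreover have "dual j \<in> Rn M" using \<open>j < k\<close> M by auto
      ultimately show ?thesis
        by (simp add: frame_def subspace_add[OF subspace_Rn])
    qed
    show "continuous_on I (\<lambda>t. frame (c t) N j)" for j
      unfolding frame_def using assms by (cases "j < 3") (simp_all add: continuous_intros)
    show "inj_on (frame (c t) N) {..<k} \<and> independent (frame (c t) N ` {..<k})" for t
      by (intro conjI biorthogonal_independent[where x = x] inner_frame_basis)
  qed
qed

text \<open>All rows after the first four carry the small factor, so the perturbing paths start in
  one family, whatever their number of rows.\<close>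

lemma frame_span_degenerate: "frame_span (chain_coeff s 0) (N + 4) = frame_span (chain_coeff s 0) 4"
proof -
  have "(\<Sum>l<N + 4. chain_coeff s 0 l j *\<^sub>R dual (k + l)) = (\<Sum>l<4. chain_coeff s 0 l j *\<^sub>R dual (k + l))" for j
    by (rule sum.mono_neutral_right) (auto simp: chain_coeff_def)
  then have "frame (chain_coeff s 0) (N + 4) = frame (chain_coeff s 0) 4"
    by (intro ext) (simp only: frame_def)
  then show ?thesis by (simp add: frame_span_def)
qed

text \<open>For the model subspace the incidences of the chain can be read off its rows. Equal
  support functions mean equal zero patterns, so they transfer to \<open>V\<close>.\<close>

lemma chain_stratum_cross_condition:
  assumes V: "subspace V" and S: "range x \<subseteq> S" and n: "n \<ge> 1" and e: "e \<noteq> 0"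
    and eq: "support_functions S V = support_functions S (frame_span (chain_coeff (1 / n) e) (2 * n + 2 + 4))"
  shows "cross_condition n (x 0) (x 1) (x (k + 0)) (x (k + 1)) V"
proof -
  \<comment> \<open>Four fixed rows, then \<open>n + 1\<close> rows each for the points
    \<open>y\<close> and \<open>z\<close>.\<close>
  define N where "N = 2 * n + 2 + 4"
  define W where "W = frame_span (chain_coeff (1 / n) e) N"
  define f where "f = frame (chain_coeff (1 / n) e) N"
  let ?y = "\<lambda>i. x (k + (4 + 2 * i))" and ?z = "\<lambda>i. x (k + (5 + 2 * i))"
  note rel = frame_span_relation[of _ "chain_coeff (1 / n) e" N, folded W_def]
  have c: "inner w (x (k + 0)) = inner w (x 0) + inner w (x 1)" if "w \<in> W" for w
    using rel[OF that, of 0] by (simp add: N_def chain_coeff_def)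
  have d: "inner w (x (k + 1)) = inner w (x 0) / n + inner w (x 1)" if "w \<in> W" for w
    using rel[OF that, of 1] by (simp add: N_def chain_coeff_def)
  have q: "inner w (x (k + 2)) = inner w (x 0) + inner w (x 2)" if "w \<in> W" for w
    using rel[OF that, of 2] by (simp add: N_def chain_coeff_def)
  have m: "inner w (x (k + 3)) = inner w (x 1) - inner w (x 2)" if "w \<in> W" for w
    using rel[OF that, of 3] by (simp add: N_def chain_coeff_def)
  have y: "inner w (?y i) = e * (inner w (x 0) + i * inner w (x 1))" if "w \<in> W" "i \<le> n" for w i
    using rel[OF that(1), of "4 + 2 * i"] that(2) by (simp add: N_def chain_coeff_def algebra_simps)
  have z: "inner w (?z i) = e * (inner w (x 0) + i * inner w (x 1) + inner w (x 2))"
    if "w \<in> W" "i \<le> n" for w i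
    using rel[OF that(1), of "5 + 2 * i"] that(2) by (simp add: N_def chain_coeff_def algebra_simps)
  have VW: "\<exists>w\<in>W. \<forall>l. inner w (x l) = 0 \<longleftrightarrow> inner v (x l) = 0" if "v \<in> V" for v
    using support_functions_eqD[OF eq[folded N_def, folded W_def] that] S by blast
  have WV: "\<exists>v\<in>V. \<forall>l. inner v (x l) = 0 \<longleftrightarrow> inner w (x l) = 0" if "w \<in> W" for w
    using support_functions_eqD[OF eq[folded N_def, folded W_def, symmetric] that] S by blast
  have fW: "f j \<in> W" if "j < 3" for j
    using that k unfolding f_def W_def by (intro frame_in_frame_span) auto
  have fx: "inner (f j) (x i) = (if i = j then 1 else 0)" if "i < 3" "j < 3" for i j
    using that k unfolding f_def by (intro inner_frame_basis) auto
  have dep: "inner v (x c) = 0" if "\<And>w. w \<in> W \<Longrightarrow> inner w (x a) = 0 \<Longrightarrow> inner w (x b) = 0 \<Longrightarrow> inner w (x c) = 0"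
    "v \<in> V" "inner v (x a) = 0" "inner v (x b) = 0" for a b c v
    using VW[OF that(2)] that by metis
  \<comment> \<open>The witnesses copy the zero patterns of the first three frame vectors, each
    nonzero on exactly one of \<open>x 0\<close>, \<open>x 1\<close>, \<open>x 2\<close>.\<close>
  obtain w0 where w0: "w0 \<in> V" "\<And>l. inner w0 (x l) = 0 \<longleftrightarrow> inner (f 0) (x l) = 0"
    using WV[OF fW, of 0] by auto
  obtain w1 where w1: "w1 \<in> V" "\<And>l. inner w1 (x l) = 0 \<longleftrightarrow> inner (f 1) (x l) = 0"
    using WV[OF fW, of 1] by auto
  obtain w2 where w2: "w2 \<in> V" "\<And>l. inner w2 (x l) = 0 \<longleftrightarrow> inner (f 2) (x l) = 0"
    using WV[OF fW, of 2] by auto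
  show ?thesis
  proof (rule von_staudt_chain[OF V, where e = "x 2" and q = "x (k + 2)" and m = "x (k + 3)"
        and y = ?y and z = ?z])
    show "w0 \<in> V" "inner w0 (x 0) \<noteq> 0" "inner w0 (x 1) = 0" "inner w0 (x 2) = 0"
      "inner w0 (x (k + 0)) \<noteq> 0" "inner w0 (x (k + 2)) \<noteq> 0"
      using w0 fx[of 0 0] fx[of 1 0] fx[of 2 0] c[OF fW[of 0]] q[OF fW[of 0]] by simp_all
    show "w1 \<in> V" "inner w1 (x 0) = 0" "inner w1 (x 1) \<noteq> 0" "inner w1 (x 2) = 0"
      "inner w1 (x (k + 0)) \<noteq> 0"
      using w1 fx[of 0 1] fx[of 1 1] fx[of 2 1] c[OF fW[of 1]] q[OF fW[of 1]] by simp_all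
    show "w2 \<in> V" "inner w2 (x 0) = 0" "inner w2 (x 1) = 0" "inner w2 (x 2) \<noteq> 0"
      "inner w2 (x (k + 2)) \<noteq> 0"
      using w2 fx[of 0 2] fx[of 1 2] fx[of 2 2] c[OF fW[of 2]] q[OF fW[of 2]] by simp_all
  next
    fix v assume v: "v \<in> V" "inner v (x 0) = 0" "inner v (x 1) = 0"
    show "inner v (x (k + 0)) = 0"
    proof (rule dep[OF _ v])
      fix w assume w: "w \<in> W" "inner w (x 0) = 0" "inner w (x 1) = 0"
      show "inner w (x (k + 0)) = 0"
        unfolding c[OF w(1)] w(2,3) by simp
    qed
  next
    fix v assume v: "v \<in> V" "inner v (x 0) = 0" "inner v (x 2) = 0"
    show "inner v (x (k + 2)) = 0"
    proof (rule dep[OF _ v])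
      fix w assume w: "w \<in> W" "inner w (x 0) = 0" "inner w (x 2) = 0"
      show "inner w (x (k + 2)) = 0"
        unfolding q[OF w(1)] w(2,3) by simp
    qed
  next
    fix v assume v: "v \<in> V" "inner v (x 1) = 0" "inner v (x 2) = 0"
    show "inner v (x (k + 3)) = 0"
    proof (rule dep[OF _ v])
      fix w assume w: "w \<in> W" "inner w (x 1) = 0" "inner w (x 2) = 0"
      show "inner w (x (k + 3)) = 0"
        unfolding m[OF w(1)] w(2,3) by simp
    qed
  next
    fix v assume v: "v \<in> V" "inner v (x (k + 2)) = 0" "inner v (x (k + 3)) = 0"
    show "inner v (x (k + 0)) = 0"
    proof (rule dep[OF _ v])
      fix w assume w: "w \<in> W" "inner w (x (k + 2)) = 0" "inner w (x (k + 3)) = 0"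
      show "inner w (x (k + 0)) = 0"
        using w(2,3) unfolding c[OF w(1)] q[OF w(1)] m[OF w(1)] by simp
    qed
  next
    fix v assume v: "v \<in> V" "inner v (x 0) = 0"
    show "inner v (?y 0) = 0"
    proof (rule dep[OF _ v v(2)])
      fix w assume w: "w \<in> W" "inner w (x 0) = 0"
      show "inner w (?y 0) = 0"
        unfolding y[OF w(1) le0] w(2) by simp
    qed
  next
    fix v i assume i: "i \<le> n" and v: "v \<in> V" "inner v (x 0) = 0" "inner v (x 1) = 0"
    show "inner v (?y i) = 0"
    proof (rule dep[OF _ v])
      fix w assume w: "w \<in> W" "inner w (x 0) = 0" "inner w (x 1) = 0"
      show "inner w (?y i) = 0"
        unfolding y[OF w(1) i] w(2,3) by simp
    qed
  next
    fix v i assume i: "i \<le> n" and v: "v \<in> V" "inner v (x (k + 2)) = 0" "inner v (x 1) = 0"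
    show "inner v (?z i) = 0"
    proof (rule dep[OF _ v])
      fix w assume w: "w \<in> W" "inner w (x (k + 2)) = 0" "inner w (x 1) = 0"
      show "inner w (?z i) = 0"
        using w(2) unfolding z[OF w(1) i] q[OF w(1)] w(3) by simp
    qed
  next
    fix v i assume i: "i \<le> n" and v: "v \<in> V" "inner v (?y i) = 0" "inner v (x 2) = 0"
    show "inner v (?z i) = 0"
    proof (rule dep[OF _ v])
      fix w assume w: "w \<in> W" "inner w (?y i) = 0" "inner w (x 2) = 0"
      show "inner w (?z i) = 0"
        using w(2) unfolding z[OF w(1) i] y[OF w(1) i] w(3) by simp
    qed
  next
    fix v i assume i: "i < n" and v: "v \<in> V" "inner v (?z i) = 0" "inner v (x (k + 3)) = 0"
    show "inner v (?y (Suc i)) = 0"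
    proof (rule dep[OF _ v])
      fix w assume w: "w \<in> W" "inner w (?z i) = 0" "inner w (x (k + 3)) = 0"
      \<comment> \<open>The scale \<open>e\<close> is nonzero and cancels.\<close>
      then have "inner w (x 0) + i * inner w (x 1) + inner w (x 2) = 0"
        using w(2) e i unfolding z[OF w(1) less_imp_le[OF i]] by simp
      moreover have "inner w (x 1) = inner w (x 2)"
        using w(3) unfolding m[OF w(1)] by simp
      ultimately show "inner w (?y (Suc i)) = 0"
        unfolding y[OF w(1) Suc_leI[OF i]] by (simp add: algebra_simps)
    qed
  next
    fix v assume v: "v \<in> V" "inner v (?y n) = 0"
    show "inner v (x (k + 1)) = 0"
    proof (rule dep[OF _ v v(2)])
      fix w assume w: "w \<in> W" "inner w (?y n) = 0"
      then have "inner w (x 0) + n * inner w (x 1) = 0"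
        using w(2) e unfolding y[OF w(1) order_refl] by simp
      then show "inner w (x (k + 1)) = 0"
        using n unfolding d[OF w(1)] by (simp add: field_simps)
    qed
  qed
qed

text \<open>At the first two frame vectors the four minors are 1, \<open>- s\<close>, -1 and 1, in
  order of appearance.\<close>

lemma cross_condition_frame_span:
  assumes "cross_condition n (x 0) (x 1) (x (k + 0)) (x (k + 1)) (frame_span (chain_coeff s 0) 4)"
  shows "real n * s = 1"
proof -
  let ?f = "frame (chain_coeff s 0) 4"
  have 0: "0 < k" "1 < k" using k by auto
  have *: "inner (?f j) (x (k + 0)) = chain_coeff s 0 0 j"
    "inner (?f j) (x (k + 1)) = chain_coeff s 0 1 j" if "j < 2" for j
    using inner_frame_extra[of 0 4 j "chain_coeff s 0"] inner_frame_extra[of 1 4 j "chain_coeff s 0"] that k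
    by auto
  have "?f 0 \<in> frame_span (chain_coeff s 0) 4" "?f 1 \<in> frame_span (chain_coeff s 0) 4"
    using 0 by (auto intro: frame_in_frame_span)
  with assms have "real n * minor (?f 0) (?f 1) (x 0) (x (k + 0)) * minor (?f 0) (?f 1) (x 1) (x (k + 1))
     = minor (?f 0) (?f 1) (x 1) (x (k + 0)) * minor (?f 0) (?f 1) (x 0) (x (k + 1))"
    unfolding cross_condition_def by blast
  then show ?thesis
    using 0 *[of 0] *[of 1] unfolding minor_def by (simp add: inner_frame_basis chain_coeff_def)
qed

section \<open>The contradiction with normality\<close>

lemma no_normal_partition:
  assumes S: "range x \<subseteq> S"
    and Q: "partition_on (grass_inf k) Q"
    and const: "\<And>U V W. U \<in> Q \<Longrightarrow> V \<in> U \<Longrightarrow> W \<in> U \<Longrightarrow> support_functions S V = support_functions S W"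
    and fin: "\<And>K. compactin (grass_inf_topology k) K \<Longrightarrow> finite {U \<in> Q. U \<inter> K \<noteq> {}}"
    and normal: "\<And>U V. U \<in> Q \<Longrightarrow> V \<in> Q \<Longrightarrow> U \<inter> grass_inf_topology k closure_of V \<noteq> {} \<Longrightarrow>
      U \<subseteq> grass_inf_topology k closure_of V"
  shows False
proof -
  let ?X = "grass_inf_topology k"
  define V where "V s = frame_span (chain_coeff s 0) 4" for s
  define W where "W n e = frame_span (chain_coeff (1 / n) e) (2 * n + 2 + 4)" for n :: nat and e
  have cont_V: "continuous_map (top_of_set {0..1}) ?X V"
    unfolding V_def by (intro continuous_map_frame_span continuous_on_chain_coeff continuous_intros)
  have cont_W: "continuous_map (top_of_set {0..1}) ?X (W n)" for n
    unfolding W_def by (intro continuous_map_frame_span continuous_on_chain_coeff continuous_intros)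
  have W0: "W n 0 = V (1 / n)" for n
    unfolding W_def V_def by (rule frame_span_degenerate)
  let ?F = "{U \<in> Q. U \<inter> V ` {0..1} \<noteq> {}}"
  have "compactin ?X (V ` {0..1})"
    by (rule image_compactin[OF _ cont_V]) (simp add: compactin_subtopology)
  then have "finite ?F" by (rule fin)
  have "\<exists>U. U \<in> ?F \<and> V (1 / real (Suc i)) \<in> U" for i
  proof -
    have i: "1 / real (Suc i) \<in> {0..1}" by simp
    then have "V (1 / real (Suc i)) \<in> \<Union>Q"
      using continuous_map_funspace[OF cont_V] partition_onD1[OF Q] by (simp add: Pi_iff)
    then show ?thesis using i by blast
  qed
  then have "\<forall>i. \<exists>U. U \<in> ?F \<and> V (1 / real (Suc i)) \<in> U" by (rule allI)
  from choice[OF this] obtain f where "\<forall>i. f i \<in> ?F \<and> V (1 / real (Suc i)) \<in> f i" ..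
  note f = this[THEN spec, THEN conjunct1] this[THEN spec, THEN conjunct2]
  then have "finite (range f)" using \<open>finite ?F\<close> by (intro finite_subset[of "range f" ?F] image_subsetI)
  \<comment> \<open>Pigeonhole: finitely many cells meet the compact arc, but there are infinitely
    many parameters.\<close>
  then have "\<not> inj f" using finite_imageD[of f UNIV] by auto
  then obtain i j where ij: "i \<noteq> j" "f i = f j" by (auto simp: inj_def)
  define n where "n = Suc j"
  obtain T t where T: "T \<in> Q" "W n 0 \<in> ?X closure_of T" "0 < t" "t \<le> 1" "W n t \<in> T"
  proof (rule locally_finite_path_start[of ?X Q "W n"])
    show "partition_on (topspace ?X) Q" using Q by simp
    show "continuous_map (top_of_set {0..1}) ?X (W n)" by (rule cont_W)
  qed (use fin in blast)+
  \<comment> \<open>The cell \<open>f j\<close> contains the start \<open>V (1 / n)\<close> of the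
    path \<open>W n\<close>; normality then pulls its other member \<open>V (1 / Suc i)\<close> into
    the closure of \<open>T\<close>.\<close>
  have "f j \<inter> ?X closure_of T \<noteq> {}"
    using f(2)[of j] T(2) by (auto simp: W0 n_def)
  then have "f j \<subseteq> ?X closure_of T"
    using normal f(1) T(1) by blast
  then have "V (1 / real (Suc i)) \<in> ?X closure_of T"
    using f(2)[of i] ij by auto
  \<comment> \<open>\<open>T\<close> contains \<open>W n t\<close> with \<open>t > 0\<close>, and
    support functions are constant on cells.\<close>
  moreover have "T \<subseteq> {V \<in> grass_inf k. cross_condition n (x 0) (x 1) (x (k + 0)) (x (k + 1)) V}"
  proof
    fix U assume U: "U \<in> T"
    then have "U \<in> grass_inf k" using T(1) partition_onD1[OF Q] by blast
    moreover have "cross_condition n (x 0) (x 1) (x (k + 0)) (x (k + 1)) U"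
    proof (rule chain_stratum_cross_condition[OF _ S])
      show "subspace U" using \<open>U \<in> grass_inf k\<close> by (auto simp: grass_inf_def grass_def)
      show "support_functions S U = support_functions S (frame_span (chain_coeff (1 / n) t) (2 * n + 2 + 4))"
        using const[OF T(1) U T(5)] by (simp add: W_def)
    qed (use T in \<open>auto simp: n_def\<close>)
    ultimately show "U \<in> {V \<in> grass_inf k. cross_condition n (x 0) (x 1) (x (k + 0)) (x (k + 1)) V}"
      by blast
  qed
  ultimately have "cross_condition n (x 0) (x 1) (x (k + 0)) (x (k + 1)) (V (1 / real (Suc i)))"
    using closure_of_minimal[OF _ closedin_cross_condition] by blast
  then have "real n * (1 / real (Suc i)) = 1"
    unfolding V_def by (rule cross_condition_frame_span)
  then show False using ij by (simp add: n_def field_simps)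
qed

end

section \<open>Extracting an orthogonal sequence and concluding for both stratifications\<close>

theorem theorem3p2:
  fixes k :: nat and A :: "nat \<Rightarrow> rinf set"
  assumes "k \<ge> 3"
    and "\<And>i. i \<ge> 1 \<Longrightarrow> finite (A i)"
    and "\<And>i. i \<ge> 1 \<Longrightarrow> A i \<subseteq> A (Suc i)"
    and "span (\<Union>i\<in>{1..}. A i) = UNIV"
    and "\<And>i a j. i \<ge> 1 \<Longrightarrow> a \<in> A (Suc i) - A i \<Longrightarrow> j < i \<Longrightarrow> coord a j = 0"
  shows "(\<nexists>Q. weak_subdivision (grass_inf_topology k)
                 (om_stratification k (\<Union>i\<in>{1..}. A i)) Q) \<and>
         (\<nexists>Q. weak_subdivision (grass_inf_topology k)
                 (matroid_stratification k (\<Union>i\<in>{1..}. A i)) Q)"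
proof -
  let ?A = "\<Union>i\<in>{1..}. A i"
  \<comment> \<open>Otherwise every element outside \<open>A (Suc n)\<close> would be zero and the
    union would lie in a single \<open>Rn M\<close>.\<close>
  have "\<exists>a\<in>?A. a \<noteq> 0 \<and> (\<forall>j<n. coord a j = 0)" for n
  proof (rule ccontr)
    assume *: "\<not> ?thesis"
    \<comment> \<open>The successor keeps the index at least 1 when \<open>n = 0\<close>.\<close>
    let ?m = "Suc n"
    obtain M where M: "A ?m \<subseteq> Rn M" using finite_subset_Rn[of "A ?m"] assms(2) by auto
    have "a \<in> Rn M" if "i \<ge> 1" "a \<in> A i" for a i
    proof (cases "a \<in> A ?m")
      case False
      \<comment> \<open>An element missing from \<open>A ?m\<close> must enter at a later stage,
        where at least the first \<open>?m\<close> coordinates vanish.\<close>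
      have "\<exists>i\<ge>?m. a \<in> A (Suc i) - A i"
      proof (rule ccontr)
        assume not: "\<not> ?thesis"
        have "a \<notin> A i" if "i \<ge> ?m" for i
          using that by (induction rule: dec_induct) (use False not in auto)
        then have "i < ?m" using \<open>a \<in> A i\<close> by (meson not_le)
        then have "i \<le> ?m" by simp
        then have "a \<in> A ?m"
          using \<open>i \<ge> 1\<close> \<open>a \<in> A i\<close>
        proof (induction rule: inc_induct)
          case (step l)
          then show ?case using assms(3)[of l] by (simp add: subset_iff)
        qed
        then show False using False by simp
      qed
      then obtain l where "l \<ge> ?m" "a \<in> A (Suc l) - A l" by blast
      then have "\<forall>j<n. coord a j = 0" using assms(5)[of l a] by auto
      then have "a = 0" using * that by force
      then show ?thesis using subspace_0[OF subspace_Rn] by simp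
    qed (use M in auto)
    then have "?A \<subseteq> Rn M" by auto
    then have "span ?A \<subseteq> Rn M" using subspace_Rn by (rule span_minimal)
    then show False using assms(4) Rn_neq_UNIV by blast
  qed
  then have "\<exists>x :: nat \<Rightarrow> rinf. (\<forall>l. x l \<in> ?A \<and> x l \<noteq> 0) \<and> (\<forall>l l'. l \<noteq> l' \<longrightarrow> inner (x l) (x l') = 0)"
    by (rule ex_orthogonal_sequence)
  then obtain x :: "nat \<Rightarrow> rinf" where x: "\<forall>l. x l \<in> ?A \<and> x l \<noteq> 0" "\<forall>l l'. l \<noteq> l' \<longrightarrow> inner (x l) (x l') = 0"
    by (elim exE conjE)
  interpret orthogonal_sequence k x
    by unfold_locales (use assms(1) x in simp_all)
  have range: "range x \<subseteq> ?A" by (rule image_subsetI) (use x(1) in blast)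
  have False if Q: "weak_subdivision (grass_inf_topology k) (om_stratification k ?A) Q" for Q
  proof (rule no_normal_partition[OF range])
    show Q1: "partition_on (grass_inf k) Q"
      using Q by (simp add: weak_subdivision_def)
    show "support_functions ?A V = support_functions ?A W" if U: "U \<in> Q" "V \<in> U" "W \<in> U" for U V W
    proof -
      have "\<forall>p\<in>om_stratification k ?A. \<exists>S\<subseteq>Q. p = \<Union>S"
        using Q by (simp add: weak_subdivision_def)
      from partition_quotient_refinement[OF Q1 this[unfolded om_stratification_def] U]
      show ?thesis by (rule sign_functions_eq_imp_support_functions_eq)
    qed
  qed (use Q in \<open>simp_all add: weak_subdivision_def\<close>)
  moreover have False if Q: "weak_subdivision (grass_inf_topology k) (matroid_stratification k ?A) Q" for Q
  proof (rule no_normal_partition[OF range])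
    show Q1: "partition_on (grass_inf k) Q"
      using Q by (simp add: weak_subdivision_def)
    show "support_functions ?A V = support_functions ?A W" if U: "U \<in> Q" "V \<in> U" "W \<in> U" for U V W
    proof -
      have "\<forall>p\<in>matroid_stratification k ?A. \<exists>S\<subseteq>Q. p = \<Union>S"
        using Q by (simp add: weak_subdivision_def)
      from partition_quotient_refinement[OF Q1 this[unfolded matroid_stratification_def] U]
      show ?thesis .
    qed
  qed (use Q in \<open>simp_all add: weak_subdivision_def\<close>)
  ultimately show ?thesis by blast
qed

end
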